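(* Let $\alpha\ge0$. The class $\mathcal{W}^0_{\mathcal{H}}(\alpha)$ is closed under convex combinations: if $f_1,\dots,f_n\in\mathcal{W}^0_{\mathcal{H}}(\alpha)$ and $0\le t_i\le1$ with $\sum_{i=1}^nt_i=1$, then $\sum_{i=1}^nt_if_i\in\mathcal{W}^0_{\mathcal{H}}(\alpha)$.
   Context: $\mathbb{D}=\{z\in\mathbb{C}:|z|<1\}$. $\mathcal{H}$ is the class of complex-valued harmonic functions $f$ in $\mathbb{D}$ with $f(0)=0$ and $f_z(0)=1$; each has the canonical representation $f=h+\overline{g}$ with $h(z)=z+\sum_{n\ge2}a_nz^n$ and $g(z)=\sum_{n\ge1}b_nz^n$ analytic in $\mathbb{D}$. For $\alpha\ge0$, $\mathcal{W}^0_{\mathcal{H}}(\alpha)$ is the class of $f=h+\overline{g}\in\mathcal{H}$ with $g'(0)=0$ and $\mathrm{Re}(h'(z)+\alpha zh''(z))>|g'(z)+\alpha zg''(z)|$ for all $z\in\mathbb{D}$. *)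

theory Defs
  imports "HOL-Complex_Analysis.Complex_Analysis"
begin

abbreviation unit_disc :: "complex set" where
  "unit_disc \<equiv> ball 0 1"

text \<open>Functions are total; only their values on \<^term>\<open>unit_disc\<close> matter, since all derivatives
  below are taken at points of this open set.\<close>

text \<open>The real partial derivatives with respect to \<open>x\<close> and \<open>y\<close>, where \<open>z = x + \<i> y\<close>.\<close>

definition partial_x :: "(complex \<Rightarrow> complex) \<Rightarrow> complex \<Rightarrow> complex" where
  "partial_x f z = vector_derivative (\<lambda>t::real. f (z + of_real t)) (at 0)"

definition partial_y :: "(complex \<Rightarrow> complex) \<Rightarrow> complex \<Rightarrow> complex" where
  "partial_y f z = vector_derivative (\<lambda>t::real. f (z + \<i> * of_real t)) (at 0)"

definition C1_on :: "complex set \<Rightarrow> (complex \<Rightarrow> complex) \<Rightarrow> bool" where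
  "C1_on S f \<longleftrightarrow>
     (\<forall>z\<in>S. (\<lambda>t::real. f (z + of_real t)) differentiable (at 0) \<and>
             (\<lambda>t::real. f (z + \<i> * of_real t)) differentiable (at 0)) \<and>
     continuous_on S (partial_x f) \<and> continuous_on S (partial_y f)"

definition C2_on :: "complex set \<Rightarrow> (complex \<Rightarrow> complex) \<Rightarrow> bool" where
  "C2_on S f \<longleftrightarrow> C1_on S f \<and> C1_on S (partial_x f) \<and> C1_on S (partial_y f)"

text \<open>Meaningful for open \<open>S\<close> only.\<close>

definition harmonic_on :: "complex set \<Rightarrow> (complex \<Rightarrow> complex) \<Rightarrow> bool" where
  "harmonic_on S f \<longleftrightarrow> C2_on S f \<and>
     (\<forall>z\<in>S. partial_x (partial_x f) z + partial_y (partial_y f) z = 0)"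

definition wirtinger_z :: "(complex \<Rightarrow> complex) \<Rightarrow> complex \<Rightarrow> complex" where
  "wirtinger_z f z = (partial_x f z - \<i> * partial_y f z) / 2"

definition class_H :: "(complex \<Rightarrow> complex) set" where
  "class_H = {f. harmonic_on unit_disc f \<and> f 0 = 0 \<and> wirtinger_z f 0 = 1}"

text \<open>The conditions at \<open>0\<close> say that the Taylor series of \<open>h\<close> starts with \<open>z\<close> and that of \<open>g\<close>
  has no constant term; they make the pair \<open>(h, g)\<close> unique on the disc.\<close>

definition canonical_rep ::
    "(complex \<Rightarrow> complex) \<Rightarrow> (complex \<Rightarrow> complex) \<Rightarrow> (complex \<Rightarrow> complex) \<Rightarrow> bool" where
  "canonical_rep f h g \<longleftrightarrow>
     h holomorphic_on unit_disc \<and> g holomorphic_on unit_disc \<and>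
     h 0 = 0 \<and> deriv h 0 = 1 \<and> g 0 = 0 \<and>
     (\<forall>z\<in>unit_disc. f z = h z + cnj (g z))"

definition class_W0H :: "real \<Rightarrow> (complex \<Rightarrow> complex) set" where
  "class_W0H \<alpha> = {f \<in> class_H. \<exists>h g. canonical_rep f h g \<and> deriv g 0 = 0 \<and>
     (\<forall>z\<in>unit_disc.
        Re (deriv h z + of_real \<alpha> * z * deriv (deriv h) z)
          > norm (deriv g z + of_real \<alpha> * z * deriv (deriv g) z))}"

end

theory Submission
  imports Defs
begin

text \<open>Every condition defining the class is either linear in \<open>(f, h, g)\<close> or, in the case of the
  inequality \<open>Re P > \<bar>Q\<bar>\<close>, survives convex combinations by the triangle inequality; strictness is
  kept because some weight is positive.\<close>

section \<open>Linearity of the partial derivatives and of \<open>C1_on\<close>\<close>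

lemma has_vector_derivative_linear_combination:
  fixes f :: "'i \<Rightarrow> complex \<Rightarrow> complex" and p :: "real \<Rightarrow> complex"
  assumes "\<And>i. i \<in> I \<Longrightarrow> (\<lambda>t. f i (p t)) differentiable (at x)"
  shows "((\<lambda>t. \<Sum>i\<in>I. c i * f i (p t)) has_vector_derivative
    (\<Sum>i\<in>I. c i * vector_derivative (\<lambda>t. f i (p t)) (at x))) (at x)"
  using assms
  by (intro has_vector_derivative_sum has_vector_derivative_mult_right)
    (simp add: vector_derivative_works)

lemma partial_x_linear_combination:
  assumes "\<And>i. i \<in> I \<Longrightarrow> (\<lambda>t::real. f i (z + of_real t)) differentiable (at 0)"
  shows "partial_x (\<lambda>z. \<Sum>i\<in>I. c i * f i z) z = (\<Sum>i\<in>I. c i * partial_x (f i) z)"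
  unfolding partial_x_def
  \<comment> \<open>The path \<open>p\<close> becomes the horizontal line through \<open>z\<close>;
    with the vertical line the same lemma serves \<open>partial_y\<close>.\<close>
  by (rule vector_derivative_at has_vector_derivative_linear_combination assms)+

lemma partial_y_linear_combination:
  assumes "\<And>i. i \<in> I \<Longrightarrow> (\<lambda>t::real. f i (z + \<i> * of_real t)) differentiable (at 0)"
  shows "partial_y (\<lambda>z. \<Sum>i\<in>I. c i * f i z) z = (\<Sum>i\<in>I. c i * partial_y (f i) z)"
  unfolding partial_y_def
  by (rule vector_derivative_at has_vector_derivative_linear_combination assms)+

lemma C1_on_partial_linear_combination:
  assumes "\<And>i. i \<in> I \<Longrightarrow> C1_on S (f i)" and "z \<in> S"
  shows "partial_x (\<lambda>z. \<Sum>i\<in>I. c i * f i z) z = (\<Sum>i\<in>I. c i * partial_x (f i) z)"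
    and "partial_y (\<lambda>z. \<Sum>i\<in>I. c i * f i z) z = (\<Sum>i\<in>I. c i * partial_y (f i) z)"
  using assms
  by (auto simp: C1_on_def intro!: partial_x_linear_combination partial_y_linear_combination)

lemma C1_on_linear_combination:
  assumes "\<And>i. i \<in> I \<Longrightarrow> C1_on S (f i)"
  shows "C1_on S (\<lambda>z. \<Sum>i\<in>I. c i * f i z)"
proof -
  let ?F = "\<lambda>z. \<Sum>i\<in>I. c i * f i z"
  have cont: "continuous_on S (\<lambda>z. \<Sum>i\<in>I. c i * partial_x (f i) z)"
    "continuous_on S (\<lambda>z. \<Sum>i\<in>I. c i * partial_y (f i) z)"
    using assms by (auto simp: C1_on_def intro!: continuous_intros)
  have "(\<lambda>t::real. ?F (z + of_real t)) differentiable (at 0)"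
    and "(\<lambda>t::real. ?F (z + \<i> * of_real t)) differentiable (at 0)" if "z \<in> S" for z
    using assms that
    by (auto simp: C1_on_def
        intro!: differentiableI_vector[OF has_vector_derivative_linear_combination])
  \<comment> \<open>Termwise differentiation is available only at points of \<open>S\<close>, so
    continuity is shown for the sum of partials and then transferred along equality on
    \<open>S\<close>.\<close>
  moreover have "continuous_on S (partial_x ?F)"
    by (rule continuous_on_eq[OF cont(1)])
      (simp add: C1_on_partial_linear_combination[where S = S] assms)
  moreover have "continuous_on S (partial_y ?F)"
    by (rule continuous_on_eq[OF cont(2)])
      (simp add: C1_on_partial_linear_combination[where S = S] assms)
  ultimately show ?thesis
    by (simp add: C1_on_def)
qed

section \<open>Locality of the partial derivatives\<close>

lemma eventually_eq_along_line:
  fixes z w :: complex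
  assumes "open S" and "\<And>z. z \<in> S \<Longrightarrow> f z = g z" and "z \<in> S"
  shows "\<forall>\<^sub>F t::real in nhds 0. f (z + w * of_real t) = g (z + w * of_real t)"
proof -
  \<comment> \<open>A short segment through \<open>z\<close> in direction \<open>w\<close> stays in
    \<open>S\<close>: the parameters landing in \<open>S\<close> form an open set containing
    0.\<close>
  have "open ((\<lambda>t::real. z + w * of_real t) -` S)"
    by (intro open_vimage assms(1) continuous_intros)
  then show ?thesis
    using assms(2,3) by (auto simp: eventually_nhds)
qed

text \<open>Derivatives along the two lines through \<open>z\<close> see only values near
  \<open>z\<close>. This allows a formula for first partials, known on \<open>S\<close> only, to be
  inserted under a second partial derivative.\<close>

lemma
  assumes "open S" and eq: "\<And>z. z \<in> S \<Longrightarrow> f z = g z" and "z \<in> S"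
  shows partial_x_cong: "partial_x f z = partial_x g z"
    and partial_y_cong: "partial_y f z = partial_y g z"
  unfolding partial_x_def partial_y_def
  using eventually_eq_along_line[OF assms, where w = 1] eventually_eq_along_line[OF assms, where w = \<i>] eq[OF assms(3)]
  by (auto intro!: vector_derivative_cong_eq simp: eventually_at_filter elim: eventually_mono)

lemma differentiable_cong_ev:
  fixes f g :: "real \<Rightarrow> complex"
  assumes "f differentiable (at x)" and "\<forall>\<^sub>F t in nhds x. f t = g t"
  shows "g differentiable (at x)"
proof -
  obtain D where "(f has_derivative D) (at x)"
    using assms(1) by (auto simp: differentiable_def)
  then have "(g has_derivative D) (at x)"
    by (rule has_derivative_transform_eventually)
      \<comment> \<open>The transfer rule wants agreement near \<open>x\<close> and agreement at
        \<open>x\<close> itself; the filter \<open>nhds x\<close> yields both.\<close>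
      (use assms(2) in \<open>auto simp: eventually_at_filter dest: eventually_nhds_x_imp_x elim: eventually_mono\<close>)
  then show ?thesis
    by (auto simp: differentiable_def)
qed

lemma C1_on_cong:
  assumes "open S" and eq: "\<And>z. z \<in> S \<Longrightarrow> f z = g z" and "C1_on S f"
  shows "C1_on S g"
proof -
  note ev = eventually_eq_along_line[where f = f and g = g, OF assms(1) eq]
  have "(\<lambda>t::real. g (z + of_real t)) differentiable (at 0)"
    and "(\<lambda>t::real. g (z + \<i> * of_real t)) differentiable (at 0)" if "z \<in> S" for z
    using assms(3) that differentiable_cong_ev[OF _ ev[where z = z and w = 1]]
      differentiable_cong_ev[OF _ ev[where z = z and w = \<i>]]
    by (simp_all add: C1_on_def)
  moreover have "continuous_on S (partial_x g)" and "continuous_on S (partial_y g)"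
    using assms(3) partial_x_cong[OF assms(1) eq] partial_y_cong[OF assms(1) eq]
    by (simp_all add: C1_on_def cong: continuous_on_cong_simp)
  ultimately show ?thesis
    by (simp add: C1_on_def)
qed

section \<open>Harmonicity and normalisation of linear combinations\<close>

lemma harmonic_on_linear_combination:
  assumes "open S" and harm: "\<And>i. i \<in> I \<Longrightarrow> harmonic_on S (f i)"
  shows "harmonic_on S (\<lambda>z. \<Sum>i\<in>I. c i * f i z)"
proof -
  let ?F = "\<lambda>z. \<Sum>i\<in>I. c i * f i z"
  let ?X = "\<lambda>z. \<Sum>i\<in>I. c i * partial_x (f i) z" and ?Y = "\<lambda>z. \<Sum>i\<in>I. c i * partial_y (f i) z"
  have C1: "\<And>i. i \<in> I \<Longrightarrow> C1_on S (f i)" "\<And>i. i \<in> I \<Longrightarrow> C1_on S (partial_x (f i))"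
    "\<And>i. i \<in> I \<Longrightarrow> C1_on S (partial_y (f i))"
    using harm by (auto simp: harmonic_on_def C2_on_def)
  have X: "partial_x ?F z = ?X z" and Y: "partial_y ?F z = ?Y z" if "z \<in> S" for z
    using C1(1) that by (simp_all add: C1_on_partial_linear_combination[where S = S])
  \<comment> \<open>Linearity gives \<open>C1_on\<close> for \<open>?X\<close>, which agrees with
    \<open>partial_x ?F\<close> on \<open>S\<close>; \<open>C1_on_cong\<close> carries it
    over.\<close>
  have "C1_on S (partial_x ?F)"
    by (rule C1_on_cong[OF assms(1) X[symmetric] C1_on_linear_combination[OF C1(2)]])
  moreover have "C1_on S (partial_y ?F)"
    by (rule C1_on_cong[OF assms(1) Y[symmetric] C1_on_linear_combination[OF C1(3)]])
  ultimately have "C2_on S ?F"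
    using C1_on_linear_combination[OF C1(1)] by (simp add: C2_on_def)
  moreover have "partial_x (partial_x ?F) z + partial_y (partial_y ?F) z = 0" if "z \<in> S" for z
  proof -
    have "partial_x (partial_x ?F) z = (\<Sum>i\<in>I. c i * partial_x (partial_x (f i)) z)"
      using partial_x_cong[OF assms(1) X that] C1(2) that
      by (simp add: C1_on_partial_linear_combination[where S = S])
    moreover have "partial_y (partial_y ?F) z = (\<Sum>i\<in>I. c i * partial_y (partial_y (f i)) z)"
      using partial_y_cong[OF assms(1) Y that] C1(3) that
      by (simp add: C1_on_partial_linear_combination[where S = S])
    \<comment> \<open>Collecting terms by index leaves \<open>c i\<close> times the Laplacian of
      \<open>f i\<close>, which vanishes on \<open>S\<close>.\<close>
    ultimately show ?thesis
      using harm that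
      by (simp add: harmonic_on_def sum.distrib[symmetric] distrib_left[symmetric])
  qed
  ultimately show ?thesis
    by (simp add: harmonic_on_def)
qed

text \<open>Harmonicity and the zero at the origin pass through by linearity; the total weight 1
  preserves the value 1 of \<open>wirtinger_z\<close> at 0.\<close>

lemma class_H_convex_combination:
  assumes f: "\<And>i. i \<in> I \<Longrightarrow> f i \<in> class_H" and "(\<Sum>i\<in>I. c i) = 1"
  shows "(\<lambda>z. \<Sum>i\<in>I. c i * f i z) \<in> class_H"
proof -
  let ?F = "\<lambda>z. \<Sum>i\<in>I. c i * f i z"
  have C1: "\<And>i. i \<in> I \<Longrightarrow> C1_on unit_disc (f i)"
    using f by (auto simp: class_H_def harmonic_on_def C2_on_def)
  have "wirtinger_z ?F 0 = (\<Sum>i\<in>I. c i * wirtinger_z (f i) 0)"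
    using C1
    by (simp add: wirtinger_z_def C1_on_partial_linear_combination[where S = unit_disc] sum_distrib_left sum_subtractf[symmetric] sum_divide_distrib
        algebra_simps)
  then have "wirtinger_z ?F 0 = 1"
    using assms by (simp add: class_H_def)
  then show ?thesis
    using f by (simp add: class_H_def harmonic_on_linear_combination)
qed

section \<open>Complex derivatives of linear combinations\<close>

lemma deriv_linear_combination:
  assumes "open S" and "\<And>i. i \<in> I \<Longrightarrow> h i holomorphic_on S" and "z \<in> S"
  shows "deriv (\<lambda>z. \<Sum>i\<in>I. c i * h i z) z = (\<Sum>i\<in>I. c i * deriv (h i) z)"
  using assms
  by (intro DERIV_imp_deriv DERIV_sum DERIV_cmult) (blast intro: holomorphic_derivI)

lemma deriv_deriv_linear_combination:
  assumes "open S" and hol: "\<And>i. i \<in> I \<Longrightarrow> h i holomorphic_on S" and "z \<in> S"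
  shows "deriv (deriv (\<lambda>z. \<Sum>i\<in>I. c i * h i z)) z = (\<Sum>i\<in>I. c i * deriv (deriv (h i)) z)"
proof -
  \<comment> \<open>The outer \<open>deriv\<close> needs the first-order formula near
    \<open>z\<close>, not just at \<open>z\<close>; openness of \<open>S\<close> provides
    this.\<close>
  have "\<forall>\<^sub>F w in nhds z. deriv (\<lambda>z. \<Sum>i\<in>I. c i * h i z) w = (\<Sum>i\<in>I. c i * deriv (h i) w)"
    using assms
    by (auto simp: eventually_nhds deriv_linear_combination[where S = S] intro!: exI[of _ S])
  then have "deriv (deriv (\<lambda>z. \<Sum>i\<in>I. c i * h i z)) z = deriv (\<lambda>w. \<Sum>i\<in>I. c i * deriv (h i) w) z"
    by (rule deriv_cong_ev) simp
  also have "\<dots> = (\<Sum>i\<in>I. c i * deriv (deriv (h i)) z)"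
    using assms by (intro deriv_linear_combination holomorphic_deriv) auto
  finally show ?thesis .
qed

lemma norm_less_Re_convex_combination:
  fixes P Q :: "'i \<Rightarrow> complex" and t :: "'i \<Rightarrow> real"
  assumes "\<And>i. i \<in> I \<Longrightarrow> norm (Q i) < Re (P i)" and t: "\<And>i. i \<in> I \<Longrightarrow> 0 \<le> t i"
    and sum: "(\<Sum>i\<in>I. t i) = 1"
  shows "norm (\<Sum>i\<in>I. of_real (t i) * Q i) < Re (\<Sum>i\<in>I. of_real (t i) * P i)"
proof -
  \<comment> \<open>A sum over an infinite set is 0 by default, so total weight 1 forces
    finiteness.\<close>
  have fin: "finite I"
    using sum sum.infinite by fastforce
  \<comment> \<open>If all the nonnegative weights vanished, their sum would be 0. The index
    \<open>j\<close> supplies the one strict term.\<close>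
  obtain j where j: "j \<in> I" "0 < t j"
    using sum t by (metis less_eq_real_def sum.neutral zero_neq_one)
  have "norm (\<Sum>i\<in>I. of_real (t i) * Q i) \<le> (\<Sum>i\<in>I. t i * norm (Q i))"
    using t by (intro order.trans[OF norm_sum] sum_mono) (simp add: norm_mult)
  also have "\<dots> < (\<Sum>i\<in>I. t i * Re (P i))"
    using assms j fin by (intro sum_strict_mono_ex1) (auto intro: mult_left_mono less_imp_le bexI[of _ j])
  finally show ?thesis
    by simp
qed

theorem theorem3p1:
  fixes \<alpha> :: real and n :: nat
    and f :: "nat \<Rightarrow> complex \<Rightarrow> complex" and t :: "nat \<Rightarrow> real"
  assumes "\<alpha> \<ge> 0"
    and "\<And>i. i \<in> {1..n} \<Longrightarrow> f i \<in> class_W0H \<alpha>"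
    and "\<And>i. i \<in> {1..n} \<Longrightarrow> 0 \<le> t i \<and> t i \<le> 1"
    and "(\<Sum>i=1..n. t i) = 1"
  shows "(\<lambda>z. \<Sum>i=1..n. of_real (t i) * f i z) \<in> class_W0H \<alpha>"
proof -
  let ?I = "{1..n}" and ?D = "\<lambda>h z. deriv h z + of_real \<alpha> * z * deriv (deriv h) z"
  have "\<forall>i\<in>?I. \<exists>h g. canonical_rep (f i) h g \<and> deriv g 0 = 0 \<and>
      (\<forall>z\<in>unit_disc. norm (?D g z) < Re (?D h z))"
    using assms(2) by (simp add: class_W0H_def)
  then obtain h g where rep: "\<And>i. i \<in> ?I \<Longrightarrow> canonical_rep (f i) (h i) (g i)"
    and g': "\<And>i. i \<in> ?I \<Longrightarrow> deriv (g i) 0 = 0"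
    and less: "\<And>i z. i \<in> ?I \<Longrightarrow> z \<in> unit_disc \<Longrightarrow> norm (?D (g i) z) < Re (?D (h i) z)"
    by metis
  \<comment> \<open>Conjugation commutes with real weights, so combining the \<open>g i\<close> with
    the same \<open>t i\<close> gives the conjugated part of the new function.\<close>
  define H G where "H = (\<lambda>z. \<Sum>i\<in>?I. of_real (t i) * h i z)"
    and "G = (\<lambda>z. \<Sum>i\<in>?I. of_real (t i) * g i z)"
  have hol: "\<And>i. i \<in> ?I \<Longrightarrow> h i holomorphic_on unit_disc"
    "\<And>i. i \<in> ?I \<Longrightarrow> g i holomorphic_on unit_disc"
    using rep by (auto simp: canonical_rep_def)
  have sum1: "(\<Sum>i\<in>?I. complex_of_real (t i)) = 1"
    using assms(4) by (metis of_real_1 of_real_sum)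
  have dH: "deriv H z = (\<Sum>i\<in>?I. of_real (t i) * deriv (h i) z)" if "z \<in> unit_disc" for z
    unfolding H_def by (rule deriv_linear_combination[OF open_ball hol(1) that])
  have ddH: "deriv (deriv H) z = (\<Sum>i\<in>?I. of_real (t i) * deriv (deriv (h i)) z)"
    if "z \<in> unit_disc" for z
    unfolding H_def by (rule deriv_deriv_linear_combination[OF open_ball hol(1) that])
  have dG: "deriv G z = (\<Sum>i\<in>?I. of_real (t i) * deriv (g i) z)" if "z \<in> unit_disc" for z
    unfolding G_def by (rule deriv_linear_combination[OF open_ball hol(2) that])
  have ddG: "deriv (deriv G) z = (\<Sum>i\<in>?I. of_real (t i) * deriv (deriv (g i)) z)"
    if "z \<in> unit_disc" for z
    unfolding G_def by (rule deriv_deriv_linear_combination[OF open_ball hol(2) that])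
  have "canonical_rep (\<lambda>z. \<Sum>i\<in>?I. of_real (t i) * f i z) H G"
    unfolding canonical_rep_def
  proof (intro conjI ballI)
    show "H holomorphic_on unit_disc" "G holomorphic_on unit_disc"
      unfolding H_def G_def using hol by (auto intro!: holomorphic_intros)
    show "H 0 = 0" "G 0 = 0"
      using rep by (simp_all add: H_def G_def canonical_rep_def)
    show "deriv H 0 = 1"
      using rep sum1 by (simp add: dH canonical_rep_def)
    show "(\<Sum>i\<in>?I. of_real (t i) * f i z) = H z + cnj (G z)" if "z \<in> unit_disc" for z
      using rep that
      by (simp add: H_def G_def canonical_rep_def sum.distrib[symmetric] distrib_left)
  qed
  moreover have "deriv G 0 = 0"
    using g' by (simp add: dG)
  moreover have "norm (?D G z) < Re (?D H z)" if z: "z \<in> unit_disc" for z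
  proof -
    \<comment> \<open>At a fixed \<open>z\<close> the operator \<open>?D\<close> is linear on
      functions holomorphic in the disc, which reduces the claim to the inequality for finitely many
      complex numbers.\<close>
    have "?D H z = (\<Sum>i\<in>?I. of_real (t i) * ?D (h i) z)"
      and "?D G z = (\<Sum>i\<in>?I. of_real (t i) * ?D (g i) z)"
      by (simp_all add: dH[OF z] dG[OF z] ddH[OF z] ddG[OF z] sum.distrib sum_distrib_left algebra_simps)
    then show ?thesis
      using norm_less_Re_convex_combination[where I = ?I and t = t, OF less[OF _ z]] assms(3,4)
      by simp
  qed
  moreover have "(\<lambda>z. \<Sum>i\<in>?I. of_real (t i) * f i z) \<in> class_H"
    using assms(2) sum1 by (intro class_H_convex_combination) (auto simp: class_W0H_def)
  ultimately show ?thesis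
    unfolding class_W0H_def by blast
qed

end
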